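(* Let $m\ge 2$ and $N\ge 1$, and let $M\in\mathfrak{ds}_m$ (a distance separated $m$-point subset of $\mathbb{R}^N$). Let $\delta=\delta(DM)$ and $0<\varepsilon<\delta/10$. Then the open ball $B_{\mathfrak{M}_m}(M,\varepsilon)=\{M'\in\mathfrak{M}_m: d_B(M,M')<\varepsilon\}$ is contained in $\mathfrak{ds}_m$. In particular, $\mathfrak{ds}_m$ is open in $(\mathfrak{M}_m,d_B)$.
   Context: $d$ denotes the Euclidean distance on $\mathbb{R}^N$. $\mathfrak{M}_m$ is the set of subsets $M\subset\mathbb{R}^N$ of cardinality $m$. For $M,M'\in\mathfrak{M}_m$ and a bijection $f:M\to M'$, $\mathrm{sep}\,f:=\max\{d(x,f(x)):x\in M\}$, and $d_B(M,M'):=\min\{\mathrm{sep}\,f: f:M\to M' \text{ a bijection}\}$; this is a metric on $\mathfrak{M}_m$. For $M\in\mathfrak{M}_m$, $DM:=\{d(x,y):x,y\in M\}$ (which contains $0$) and $DM_+:=DM\setminus\{0\}$; the mesh $\delta(DM):=\min\{|r-r'|: r,r'\in DM,\ r\neq r'\}$. $M$ is distance separated if $|DM_+|=m(m-1)/2$, equivalently, $d(x,y)=d(x',y')\neq 0$ implies $(x,y)=(x',y')$ or $(x,y)=(y',x')$. $\mathfrak{ds}_m\subset\mathfrak{M}_m$ is the set of distance separated spaces. *)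

theory Defs
  imports "HOL-Analysis.Analysis"
begin

definition msets :: "nat \<Rightarrow> (real^'n) set set" where
  "msets m = {M. finite M \<and> card M = m}"

definition sep :: "(real^'n \<Rightarrow> real^'n) \<Rightarrow> (real^'n) set \<Rightarrow> real" where
  "sep f M = Max ((\<lambda>x. dist x (f x)) ` M)"

text \<open>
  The distance is meant for two nonempty finite sets of equal cardinality. Elsewhere it is set
  to 0, because the locale \<^locale>\<open>Metric_space\<close> asks for nonnegativity and symmetry on the
  whole type. The minimum is over a finite nonempty set of reals although the functions range
  over the whole function type: only the restriction of \<open>f\<close> to \<open>M\<close> matters.
\<close>
definition dB :: "(real^'n) set \<Rightarrow> (real^'n) set \<Rightarrow> real" where
  "dB M M' =
    (if finite M \<and> finite M' \<and> M \<noteq> {} \<and> card M = card M'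
     then Min {sep f M | f. bij_betw f M M'} else 0)"

definition DM :: "(real^'n) set \<Rightarrow> real set" where
  "DM M = {dist x y | x y. x \<in> M \<and> y \<in> M}"

definition DM_plus :: "(real^'n) set \<Rightarrow> real set" where
  "DM_plus M = DM M - {0}"

definition mesh :: "real set \<Rightarrow> real" where
  "mesh D = Min {\<bar>r - r'\<bar> | r r'. r \<in> D \<and> r' \<in> D \<and> r \<noteq> r'}"

definition ds :: "nat \<Rightarrow> (real^'n) set set" where
  "ds m = {M \<in> msets m. card (DM_plus M) = m * (m - 1) div 2}"

lemma finite_sep_values:
  assumes "finite M" "finite M'" "M \<noteq> {}"
  shows "finite {sep f M | f. bij_betw f M M'}"
proof -
  have "{sep f M | f. bij_betw f M M'} \<subseteq> (\<lambda>(x, y). dist x y) ` (M \<times> M')"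
  proof clarify
    fix f assume f: "bij_betw f M M'"
    have "sep f M \<in> (\<lambda>x. dist x (f x)) ` M"
      unfolding sep_def using assms by (intro Max_in) auto
    then show "sep f M \<in> (\<lambda>(x, y). dist x y) ` (M \<times> M')"
      using bij_betwE[OF f] by force
  qed
  then show ?thesis
    by (rule finite_subset) (use assms in auto)
qed

lemma dB_attained:
  assumes "finite M" "finite M'" "M \<noteq> {}" "card M = card M'"
  obtains f where "bij_betw f M M'" "dB M M' = sep f M"
proof -
  let ?S = "{sep f M | f. bij_betw f M M'}"
  have "?S \<noteq> {}"
    using finite_same_card_bij[OF assms(1,2,4)] by auto
  then have "Min ?S \<in> ?S"
    using finite_sep_values assms by (intro Min_in) auto
  then show ?thesis
    using that assms unfolding dB_def by auto
qed

lemma dB_le_sep: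
  assumes "finite M" "finite M'" "M \<noteq> {}" "bij_betw f M M'"
  shows "dB M M' \<le> sep f M"
proof -
  have "dB M M' = Min {sep f M | f. bij_betw f M M'}"
    using assms bij_betw_same_card[OF assms(4)] by (simp add: dB_def)
  then show ?thesis
    using finite_sep_values[OF assms(1-3)] assms(4) by (auto intro!: Min_le)
qed

lemma dist_le_sep: "finite M \<Longrightarrow> x \<in> M \<Longrightarrow> dist x (f x) \<le> sep f M"
  unfolding sep_def by (intro Max_ge) auto

lemma sep_le:
  assumes "finite M" "M \<noteq> {}" "\<And>x. x \<in> M \<Longrightarrow> dist x (f x) \<le> c"
  shows "sep f M \<le> c"
  unfolding sep_def using assms by (subst Max_le_iff) auto

lemma dB_commute_le:
  assumes "finite M" "finite M'" "M \<noteq> {}" "card M = card M'"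
  shows "dB M' M \<le> dB M M'"
proof -
  obtain f where f: "bij_betw f M M'" "dB M M' = sep f M"
    using dB_attained[OF assms] .
  have ne: "M' \<noteq> {}"
    using assms by auto
  have "sep (inv_into M f) M' \<le> sep f M"
  proof (rule sep_le[OF assms(2) ne])
    fix y assume y: "y \<in> M'"
    have "inv_into M f y \<in> M" "f (inv_into M f y) = y"
      using f(1) y by (auto simp: bij_betw_def inv_into_into f_inv_into_f)
    then show "dist y (inv_into M f y) \<le> sep f M"
      using dist_le_sep[OF assms(1), of "inv_into M f y" f] by (simp add: dist_commute)
  qed
  then show ?thesis
    using dB_le_sep[OF assms(2,1) ne bij_betw_inv_into[OF f(1)]] f(2) by linarith
qed

lemma Metric_space_msets: "Metric_space (msets m :: (real^'n) set set) dB"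
proof
  show nonneg: "0 \<le> dB M M'" for M M' :: "(real^'n) set"
  proof (cases "finite M \<and> finite M' \<and> M \<noteq> {} \<and> card M = card M'")
    case True
    then obtain f where "dB M M' = sep f M"
      using dB_attained by metis
    moreover obtain x where "x \<in> M"
      using True by blast
    ultimately show ?thesis
      using dist_le_sep[of M x f] True by (metis order_trans zero_le_dist)
  qed (auto simp: dB_def)
  show "dB M M' = dB M' M" for M M' :: "(real^'n) set"
  proof (cases "finite M \<and> finite M' \<and> M \<noteq> {} \<and> card M = card M'")
    case True
    then have "M' \<noteq> {}"
      by auto
    then show ?thesis
      using True dB_commute_le[of M M'] dB_commute_le[of M' M] by auto
  next
    case False
    then have "\<not> (finite M' \<and> finite M \<and> M' \<noteq> {} \<and> card M' = card M)"
      by (metis card_0_eq)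
    with False show ?thesis
      by (simp only: dB_def if_False)
  qed
  show "dB M M' = 0 \<longleftrightarrow> M = M'"
    if "M \<in> msets m" "M' \<in> msets m" for M M' :: "(real^'n) set"
  proof (cases "M = {}")
    case True
    with that show ?thesis
      by (auto simp: dB_def msets_def)
  next
    case ne: False
    have fin: "finite M" "finite M'" "card M = card M'"
      using that by (auto simp: msets_def)
    show ?thesis
    proof
      assume "dB M M' = 0"
      moreover obtain f where f: "bij_betw f M M'" "dB M M' = sep f M"
        using dB_attained fin ne by metis
      ultimately have "f x = x" if "x \<in> M" for x
        using dist_le_sep[OF fin(1) that, of f] by simp
      then have "f ` M = M"
        by force
      then show "M = M'"
        using f(1) by (simp add: bij_betw_def)
    next
      assume eq: "M = M'"
      have "dB M M \<le> sep (\<lambda>x. x) M"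
        using dB_le_sep[of M M "\<lambda>x. x"] fin(1) ne by (simp add: bij_betw_def)
      also have "\<dots> \<le> 0"
        using fin(1) ne by (intro sep_le) auto
      finally show "dB M M' = 0"
        using nonneg[of M M] eq by simp
    qed
  qed
  show "dB L K \<le> dB L M + dB M K"
    if "L \<in> msets m" "M \<in> msets m" "K \<in> msets m" for L M K :: "(real^'n) set"
  proof (cases "L = {}")
    case True
    with that show ?thesis
      by (auto simp: dB_def msets_def)
  next
    case ne: False
    have fin: "finite L" "finite M" "finite K" "card L = card M" "card M = card K"
      using that by (auto simp: msets_def)
    then have ne': "M \<noteq> {}"
      using ne by auto
    obtain f where f: "bij_betw f L M" "dB L M = sep f L"
      using dB_attained fin ne by metis
    obtain g where g: "bij_betw g M K" "dB M K = sep g M"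
      using dB_attained fin ne' by metis
    have "dB L K \<le> sep (g \<circ> f) L"
      using fin ne bij_betw_trans[OF f(1) g(1)] by (intro dB_le_sep)
    also have "\<dots> \<le> sep f L + sep g M"
    proof (rule sep_le[OF fin(1) ne])
      fix x assume x: "x \<in> L"
      then have "f x \<in> M"
        using f(1) by (auto simp: bij_betw_def)
      then show "dist x ((g \<circ> f) x) \<le> sep f L + sep g M"
        using dist_le_sep[OF fin(1) x, of f] dist_le_sep[OF fin(2), of "f x" g]
          dist_triangle[of x "g (f x)" "f x"] by simp
    qed
    finally show ?thesis
      using f(2) g(2) by simp
  qed
qed

end

theory Submission
  imports Defs
begin

text \<open>
  An \<open>m\<close>-point set has at most \<open>m (m - 1) / 2\<close> positive distances, so only a lower bound is
  needed. A bijection that moves points by less than \<open>\<epsilon>\<close> changes distances by less than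
  \<open>2 \<epsilon>\<close>; as distinct distances of \<open>M\<close> differ by at least the mesh, which exceeds \<open>4 \<epsilon>\<close>, they
  stay distinct, and they stay positive by injectivity.
\<close>

lemma finite_DM: "finite M \<Longrightarrow> finite (DM M)"
  by (rule finite_subset[of _ "(\<lambda>(x, y). dist x y) ` (M \<times> M)"]) (auto simp: DM_def)

lemma finite_DM_plus: "finite M \<Longrightarrow> finite (DM_plus M)"
  by (simp add: DM_plus_def finite_DM)

lemma DM_plusE:
  assumes "r \<in> DM_plus M"
  obtains x y where "x \<in> M" "y \<in> M" "x \<noteq> y" "dist x y = r"
  using assms by (auto simp: DM_plus_def DM_def)

lemma DM_plusI: "x \<in> M \<Longrightarrow> y \<in> M \<Longrightarrow> x \<noteq> y \<Longrightarrow> dist x y \<in> DM_plus M"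
  by (auto simp: DM_plus_def DM_def)

text \<open>Picking for each positive distance a pair of points realising it gives an injection into
  the two-element subsets of \<open>M\<close>: by symmetry of \<open>dist\<close>, the unordered
  pair determines the distance.\<close>

lemma card_DM_plus_le:
  assumes "finite M"
  shows "card (DM_plus M) \<le> card M * (card M - 1) div 2"
proof -
  have "\<forall>r\<in>DM_plus M. \<exists>p. fst p \<in> M \<and> snd p \<in> M \<and> fst p \<noteq> snd p \<and> dist (fst p) (snd p) = r"
    by (metis DM_plusE fst_conv snd_conv)
  then obtain p where p: "fst (p r) \<in> M" "snd (p r) \<in> M" "fst (p r) \<noteq> snd (p r)"
      "dist (fst (p r)) (snd (p r)) = r" if "r \<in> DM_plus M" for r
    by metis
  have "inj_on (\<lambda>r. {fst (p r), snd (p r)}) (DM_plus M)"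
    by (rule inj_onI) (metis p(4) dist_commute doubleton_eq_iff)
  moreover have "(\<lambda>r. {fst (p r), snd (p r)}) ` DM_plus M \<subseteq> {S. S \<subseteq> M \<and> card S = 2}"
    using p by auto
  ultimately have "card (DM_plus M) \<le> card {S. S \<subseteq> M \<and> card S = 2}"
    using assms by (intro card_inj_on_le) auto
  then show ?thesis
    using assms by (simp add: n_subsets choose_two)
qed

lemma finite_mesh_set:
  assumes "finite D"
  shows "finite {\<bar>r - r'\<bar> | r r'. r \<in> D \<and> r' \<in> D \<and> r \<noteq> r'}"
  by (rule finite_subset[of _ "(\<lambda>(r, r'). \<bar>r - r'\<bar>) ` (D \<times> D)"]) (use assms in auto)

lemma mesh_le: "finite D \<Longrightarrow> r \<in> D \<Longrightarrow> r' \<in> D \<Longrightarrow> r \<noteq> r' \<Longrightarrow> mesh D \<le> \<bar>r - r'\<bar>"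
  unfolding mesh_def by (rule Min_le[OF finite_mesh_set]) auto

lemma mesh_pos:
  assumes "finite D" "r \<in> D" "r' \<in> D" "r \<noteq> r'"
  shows "0 < mesh D"
  unfolding mesh_def by (subst Min_gr_iff[OF finite_mesh_set[OF assms(1)]]) (use assms in auto)

text \<open>Each positive distance of \<open>M\<close> has a positive distance of \<open>M'\<close>
  within half the mesh, and a choice of such values is injective. This holds for any finite
  \<open>M\<close>; distance separation enters only in \<open>mball_subset_ds\<close>.\<close>

lemma card_DM_plus_mono:
  assumes fin: "finite M" and f: "bij_betw f M M'"
    and close: "\<And>x. x \<in> M \<Longrightarrow> dist x (f x) < mesh (DM M) / 4"
  shows "card (DM_plus M) \<le> card (DM_plus M')"
proof -
  have "\<exists>s\<in>DM_plus M'. \<bar>s - r\<bar> < mesh (DM M) / 2" if "r \<in> DM_plus M" for r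
  proof -
    obtain x y where xy: "x \<in> M" "y \<in> M" "x \<noteq> y" "dist x y = r"
      using DM_plusE[OF \<open>r \<in> DM_plus M\<close>] .
    have "f x \<in> M'" "f y \<in> M'" "f x \<noteq> f y"
      using f xy by (auto simp: bij_betw_def inj_on_def)
    \<comment> \<open>The four triangle inequalities bound the change by
      \<open>dist x (f x) + dist y (f y)\<close>, which is less than two quarters of the
      mesh.\<close>
    moreover have "\<bar>dist (f x) (f y) - r\<bar> < mesh (DM M) / 2"
      using close[OF xy(1)] close[OF xy(2)] xy(4)
        dist_triangle[of x y "f x"] dist_triangle[of "f x" y "f y"]
        dist_triangle[of "f x" "f y" x] dist_triangle[of x "f y" y]
      unfolding dist_commute[of "f x" x] dist_commute[of "f y" y] by linarith
    ultimately show ?thesis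
      using DM_plusI by blast
  qed
  then obtain h where h: "h r \<in> DM_plus M'" "\<bar>h r - r\<bar> < mesh (DM M) / 2"
    if "r \<in> DM_plus M" for r
    by metis
  have "inj_on h (DM_plus M)"
  proof (rule inj_onI, rule ccontr)
    fix r r' assume r: "r \<in> DM_plus M" "r' \<in> DM_plus M" "h r = h r'" "r \<noteq> r'"
    then have "mesh (DM M) \<le> \<bar>r - r'\<bar>"
      by (intro mesh_le finite_DM fin) (auto simp: DM_plus_def)
    \<comment> \<open>Both \<open>r\<close> and \<open>r'\<close> lie within half the mesh of the
      common value \<open>h r\<close>, hence less than the mesh apart.\<close>
    then show False
      using h(2)[OF r(1)] h(2)[OF r(2)] r(3) by linarith
  qed
  moreover have "finite (DM_plus M')"
    using f fin by (simp add: bij_betw_finite finite_DM_plus)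
  ultimately show ?thesis
    using h(1) by (intro card_inj_on_le) auto
qed

text \<open>The count of positive distances is already maximal for \<open>M\<close> and cannot drop,
  so it is maximal for \<open>M'\<close>. Equality with a quarter of the mesh is allowed because the
  ball is open.\<close>

lemma mball_subset_ds:
  assumes "m \<ge> 1" "M \<in> ds m" "\<epsilon> \<le> mesh (DM M) / 4"
  shows "Metric_space.mball (msets m) dB M \<epsilon> \<subseteq> ds m"
proof
  fix M' assume "M' \<in> Metric_space.mball (msets m) dB M \<epsilon>"
  then have M': "M' \<in> msets m" "dB M M' < \<epsilon>"
    by (simp_all add: Metric_space.in_mball[OF Metric_space_msets])
  \<comment> \<open>Nonemptiness, from \<open>m \<ge> 1\<close>, makes \<open>dB M M'\<close> a true
    minimum rather than the default 0.\<close>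
  have fin: "finite M" "finite M'" "card M = m" "card M' = m" "M \<noteq> {}"
    using assms(1,2) M'(1) by (auto simp: ds_def msets_def)
  obtain f where f: "bij_betw f M M'" "dB M M' = sep f M"
    using dB_attained[of M M'] fin by metis
  have "card (DM_plus M) \<le> card (DM_plus M')"
    using dist_le_sep[OF fin(1), of _ f] M'(2) f(2) assms(3)
    by (intro card_DM_plus_mono[OF fin(1) f(1)]) fastforce
  with card_DM_plus_le[OF fin(2)] show "M' \<in> ds m"
    using assms(2) M'(1) fin(4) by (simp add: ds_def)
qed

lemma mesh_DM_pos:
  assumes "finite M" "card M \<ge> 2"
  shows "0 < mesh (DM M)"
proof -
  obtain x y where "x \<in> M" "y \<in> M" "x \<noteq> y"
    using assms by (metis card_2_iff' obtain_subset_with_card_n subset_iff)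
  then show ?thesis
    using finite_DM[OF assms(1)]
    \<comment> \<open>The second witness is the distance 0, so a single pair of distinct points
      suffices, even when \<open>M\<close> has only two points.\<close>
    by (intro mesh_pos[where r = "dist x y" and r' = "dist x x"]) (auto simp: DM_def)
qed

theorem theorem3p7:
  fixes m :: nat
  assumes "m \<ge> 2"
  shows "(\<forall>(M :: (real^'n) set) (\<epsilon> :: real).
            M \<in> ds m \<longrightarrow> 0 < \<epsilon> \<longrightarrow> \<epsilon> < mesh (DM M) / 10 \<longrightarrow>
            Metric_space.mball (msets m) dB M \<epsilon> \<subseteq> ds m)
       \<and> openin (Metric_space.mtopology (msets m) dB) (ds m :: (real^'n) set set)"
proof (intro conjI allI impI)
  fix M :: "(real^'n) set" and \<epsilon> :: real
  assume "M \<in> ds m" "0 < \<epsilon>" "\<epsilon> < mesh (DM M) / 10"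
  then show "Metric_space.mball (msets m) dB M \<epsilon> \<subseteq> ds m"
    using assms by (intro mball_subset_ds) auto
next
  have "\<exists>r>0. Metric_space.mball (msets m) dB M r \<subseteq> ds m"
    if "M \<in> ds m" for M :: "(real^'n) set"
  proof (intro exI conjI)
    \<comment> \<open>A quarter of the mesh is the largest radius that
      \<open>mball_subset_ds\<close> covers.\<close>
    show "0 < mesh (DM M) / 4"
      using mesh_DM_pos[of M] that assms by (auto simp: ds_def msets_def)
    show "Metric_space.mball (msets m) dB M (mesh (DM M) / 4) \<subseteq> ds m"
      using that assms by (intro mball_subset_ds) auto
  qed
  moreover have "ds m \<subseteq> (msets m :: (real^'n) set set)"
    by (auto simp: ds_def)
  ultimately show "openin (Metric_space.mtopology (msets m) dB) (ds m :: (real^'n) set set)"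
    by (simp add: Metric_space.openin_mtopology[OF Metric_space_msets])
qed

end
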